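(* Let $\lambda$ be a nonzero real number and let $x,y\in\mathbb{R}$. For every integer $n\ge 0$, $$\mathcal{E}_{n,\lambda}^{(c)}(1-x,y)=(-1)^{n}\mathcal{E}_{n,-\lambda}^{(c)}(x,y)$$ and $$\mathcal{E}_{n,\lambda}^{(s)}(1-x,y)=(-1)^{n+1}\mathcal{E}_{n,-\lambda}^{(s)}(x,y).$$
   Context: All generating functions are power series in $t$ around $t=0$. For nonzero $\lambda\in\mathbb{R}$ and complex $z$, the degenerate exponential is $e_\lambda^{z}(t)=(1+\lambda t)^{z/\lambda}$, and $e_\lambda(t)=e_\lambda^1(t)$. The degenerate cosine and sine functions are $\cos_\lambda^{(y)}(t)=\frac{e_\lambda^{iy}(t)+e_\lambda^{-iy}(t)}{2}=\cos\left(\frac{y}{\lambda}\log(1+\lambda t)\right)$ and $\sin_\lambda^{(y)}(t)=\frac{e_\lambda^{iy}(t)-e_\lambda^{-iy}(t)}{2i}=\sin\left(\frac{y}{\lambda}\log(1+\lambda t)\right)$, with $i=\sqrt{-1}$. For any nonzero real $\lambda$ (positive or negative), the degenerate cosine-Euler and sine-Euler polynomials are defined by $\frac{2}{e_\lambda(t)+1}e_\lambda^{x}(t)\cos_\lambda^{(y)}(t)=\sum_{n=0}^{\infty}\mathcal{E}_{n,\lambda}^{(c)}(x,y)\frac{t^n}{n!}$ and $\frac{2}{e_\lambda(t)+1}e_\lambda^{x}(t)\sin_\lambda^{(y)}(t)=\sum_{n=0}^{\infty}\mathcal{E}_{n,\lambda}^{(s)}(x,y)\frac{t^n}{n!}$.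 *)

theory Defs
  imports "HOL-Complex_Analysis.Complex_Analysis"
begin

text \<open>
  The generating functions are treated as functions of a complex variable \<open>t\<close>, analytic at \<open>t = 0\<close>.
  The power is the principal branch, so \<open>deg_exp l z 0 = 1\<close>. All definitions are meant for
  \<open>l \<noteq> 0\<close> only.
\<close>

definition deg_exp :: "real \<Rightarrow> complex \<Rightarrow> complex \<Rightarrow> complex" where
  "deg_exp l z t = (1 + of_real l * t) powr (z / of_real l)"

definition deg_cos :: "real \<Rightarrow> real \<Rightarrow> complex \<Rightarrow> complex" where
  "deg_cos l y t = (deg_exp l (\<i> * of_real y) t + deg_exp l (- (\<i> * of_real y)) t) / 2"

definition deg_sin :: "real \<Rightarrow> real \<Rightarrow> complex \<Rightarrow> complex" where
  "deg_sin l y t = (deg_exp l (\<i> * of_real y) t - deg_exp l (- (\<i> * of_real y)) t) / (2 * \<i>)"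

definition cos_euler_gf :: "real \<Rightarrow> real \<Rightarrow> real \<Rightarrow> complex \<Rightarrow> complex" where
  "cos_euler_gf l x y t = 2 / (deg_exp l 1 t + 1) * deg_exp l (of_real x) t * deg_cos l y t"

definition sin_euler_gf :: "real \<Rightarrow> real \<Rightarrow> real \<Rightarrow> complex \<Rightarrow> complex" where
  "sin_euler_gf l x y t = 2 / (deg_exp l 1 t + 1) * deg_exp l (of_real x) t * deg_sin l y t"

text \<open>
  The values of the polynomials are real; they are kept in type \<^typ>\<open>complex\<close>, where the
  coefficients of the expansion live. See \<open>cos_euler_expansion\<close> and \<open>sin_euler_expansion\<close>
  below for the defining identities.
\<close>

definition cos_euler :: "nat \<Rightarrow> real \<Rightarrow> real \<Rightarrow> real \<Rightarrow> complex" where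
  "cos_euler n l x y = fact n * fps_nth (fps_expansion (cos_euler_gf l x y) 0) n"

definition sin_euler :: "nat \<Rightarrow> real \<Rightarrow> real \<Rightarrow> real \<Rightarrow> complex" where
  "sin_euler n l x y = fact n * fps_nth (fps_expansion (sin_euler_gf l x y) 0) n"

lemma deg_exp_analytic: "deg_exp l z analytic_on {0}"
  unfolding deg_exp_def by (intro analytic_intros) auto

lemma deg_exp_0 [simp]: "deg_exp l z 0 = 1"
  by (simp add: deg_exp_def)

lemma cos_euler_gf_analytic: "cos_euler_gf l x y analytic_on {0}"
  unfolding cos_euler_gf_def deg_cos_def
  by (intro analytic_intros deg_exp_analytic) auto

lemma sin_euler_gf_analytic: "sin_euler_gf l x y analytic_on {0}"
  unfolding sin_euler_gf_def deg_sin_def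
  by (intro analytic_intros deg_exp_analytic) auto

lemma cos_euler_expansion:
  "cos_euler_gf l x y has_fps_expansion Abs_fps (\<lambda>n. cos_euler n l x y / fact n)"
proof -
  have "Abs_fps (\<lambda>n. cos_euler n l x y / fact n) = fps_expansion (cos_euler_gf l x y) 0"
    by (simp add: fps_eq_iff cos_euler_def)
  thus ?thesis
    using analytic_at_imp_has_fps_expansion_0[OF cos_euler_gf_analytic] by simp
qed

lemma sin_euler_expansion:
  "sin_euler_gf l x y has_fps_expansion Abs_fps (\<lambda>n. sin_euler n l x y / fact n)"
proof -
  have "Abs_fps (\<lambda>n. sin_euler n l x y / fact n) = fps_expansion (sin_euler_gf l x y) 0"
    by (simp add: fps_eq_iff sin_euler_def)
  thus ?thesis
    using analytic_at_imp_has_fps_expansion_0[OF sin_euler_gf_analytic] by simp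
qed

lemma deg_cos_eq_cos:
  assumes "1 + of_real l * t \<noteq> 0"
  shows "deg_cos l y t = cos (of_real y / of_real l * Ln (1 + of_real l * t))"
  using assms by (simp add: deg_cos_def deg_exp_def powr_def cos_exp_eq mult_ac)

lemma deg_sin_eq_sin:
  assumes "1 + of_real l * t \<noteq> 0"
  shows "deg_sin l y t = sin (of_real y / of_real l * Ln (1 + of_real l * t))"
  using assms by (simp add: deg_sin_def deg_exp_def powr_def sin_exp_eq mult_ac)

end

theory Submission
  imports Defs
begin

text \<open>
  Replacing \<open>(l, t)\<close> by \<open>(- l, - t)\<close> leaves \<open>1 + l t\<close> fixed and inverts the degenerate
  exponential, so the factor \<open>2 / (e + 1)\<close> picks up one extra \<open>e\<close>, which turns the
  exponent \<open>- x\<close> into \<open>1 - x\<close>. The cosine is even and the sine odd under this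
  substitution; comparing coefficients at \<open>t = 0\<close> gives both identities.
\<close>

lemma deg_exp_minus_minus: "deg_exp (- l) z (- t) = deg_exp l (- z) t"
  by (simp add: deg_exp_def)

lemma deg_cos_minus_minus: "deg_cos (- l) y (- t) = deg_cos l y t"
  by (simp add: deg_cos_def deg_exp_minus_minus add.commute)

lemma deg_sin_minus_minus: "deg_sin (- l) y (- t) = - deg_sin l y t"
  by (simp add: deg_sin_def deg_exp_minus_minus field_simps)

text \<open>With \<open>E = deg_exp l 1 t\<close>, which is invertible here, this is
  \<open>2 * E / (E + 1) = 2 / (inverse E + 1)\<close> times a common power.\<close>

lemma deg_exp_quotient_reflect:
  assumes "l \<noteq> 0" "1 + of_real l * t \<noteq> 0"
  shows "2 / (deg_exp l 1 t + 1) * deg_exp l (of_real (1 - x)) t =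
         2 / (deg_exp l (- 1) t + 1) * deg_exp l (- of_real x) t"
proof -
  define E where "E = deg_exp l 1 t"
  have E: "E \<noteq> 0" "deg_exp l (- 1) t = inverse E"
    using assms by (simp_all add: E_def deg_exp_def powr_minus)
  have "deg_exp l (of_real (1 - x)) t = E * deg_exp l (- of_real x) t"
    by (simp add: E_def deg_exp_def diff_divide_distrib flip: powr_add)
  moreover have "inverse E + 1 = (E + 1) / E"
    using E(1) by (simp add: field_simps)
  \<comment> \<open>The case \<open>E = -1\<close> is covered too: both denominators vanish and both
    sides are 0.\<close>
  ultimately show ?thesis
    by (simp add: E(2) flip: E_def)
qed

lemma eventually_one_plus_mult_nonzero: "\<forall>\<^sub>F t in nhds 0. 1 + c * t \<noteq> (0 :: complex)"
proof (rule eventually_nhds_in_open[THEN eventually_mono])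
  show "open {t. 1 + c * t \<noteq> 0}"
    by (intro open_Collect_neq continuous_intros)
qed auto

text \<open>Composing with \<open>- fps_X\<close> scales coefficient \<open>n\<close> by
  \<open>(-1) ^ n\<close>, and agreement near 0 suffices because the germ determines the
  series.\<close>

lemma fps_nth_reflect:
  fixes f g :: "complex \<Rightarrow> complex"
  assumes f: "f has_fps_expansion F" and g: "g has_fps_expansion G"
    and eq: "\<forall>\<^sub>F t in nhds 0. f t = g (- t)"
  shows "fps_nth F n = (-1) ^ n * fps_nth G n"
proof -
  have "(\<lambda>t. g (- t)) has_fps_expansion fps_compose G (- fps_X)"
    using has_fps_expansion_compose[OF g has_fps_expansion_minus[OF has_fps_expansion_fps_X]]
    by (simp add: o_def)
  moreover have "(\<lambda>t. g (- t)) has_fps_expansion F"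
    using f has_fps_expansion_cong[OF eq refl] by blast
  ultimately have "F = fps_compose G (- fps_X)"
    by (metis fps_expansion_unique_complex)
  thus ?thesis
    by (simp add: fps_compose_uminus')
qed

theorem theorem2p6:
  fixes l x y :: real and n :: nat
  assumes "l \<noteq> 0"
  shows "cos_euler n l (1 - x) y = (-1) ^ n * cos_euler n (- l) x y
       \<and> sin_euler n l (1 - x) y = (-1) ^ (n + 1) * sin_euler n (- l) x y"
proof
  note ev = eventually_mono[OF eventually_one_plus_mult_nonzero[of "of_real l"]]
  have "\<forall>\<^sub>F t in nhds 0. cos_euler_gf l (1 - x) y t = cos_euler_gf (- l) x y (- t)"
    by (rule ev) (simp only: cos_euler_gf_def deg_exp_minus_minus deg_cos_minus_minus
        deg_exp_quotient_reflect[OF assms] not_False_eq_True)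
  from fps_nth_reflect[OF cos_euler_expansion cos_euler_expansion this, of n]
  show "cos_euler n l (1 - x) y = (-1) ^ n * cos_euler n (- l) x y"
    by simp
  have "\<forall>\<^sub>F t in nhds 0. sin_euler_gf l (1 - x) y t = - sin_euler_gf (- l) x y (- t)"
    by (rule ev) (simp only: sin_euler_gf_def deg_exp_minus_minus deg_sin_minus_minus
        deg_exp_quotient_reflect[OF assms] mult_minus_right minus_minus
        not_False_eq_True)
  \<comment> \<open>The sign from oddness is absorbed into the second series, which raises the
    exponent to \<open>n + 1\<close>.\<close>
  from fps_nth_reflect[OF sin_euler_expansion has_fps_expansion_minus[OF sin_euler_expansion]
      this, of n]
  show "sin_euler n l (1 - x) y = (-1) ^ (n + 1) * sin_euler n (- l) x y"
    by (simp add: field_simps)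
qed

end
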